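(* Fix a finite set of letters and a total ordering on the set of normalized regular expressions over these letters. Let $\cong$ be the congruence on plain regular expressions and let $E\mapsto\overline{E}$ be the normalization map from plain regular expressions to normalized expressions, both defined in the context. Then for all plain regular expressions $E$ and $E'$, if $E\cong E'$, then $\overline{E}$ and $\overline{E'}$ are the same (syntactically identical) normalized expression.
   Context: **Plain regular expressions.** A plain regular expression is either the symbol $0$, or the symbol $1$, or a letter, or $E_1+E_2$, or $E_1\cdot E_2$, or $E^*$, where $E,E_1,E_2$ are (simpler) plain regular expressions; these are purely syntactic objects. **Congruence.** $\cong$ is the least congruence (equivalence relation compatible with the constructors $+$, $\cdot$, ${}^*$) on the set of plain regular expressions containing the following equivalences, for all plain regular expressions $E,E_1,E_2,E_3$: $E+E\cong 0+E\cong E\cong E+0$; $\;0\cdot E\cong 0\cong E\cdot 0$; $\;1\cdot E\cong E\cong E\cdot 1$; $\;E_1+(E_2+E_3)\cong(E_1+E_2)+E_3$; $\;E_1+E_2\cong E_2+E_1$; $\;E_1\cdot(E_2\cdot E_3)\cong(E_1\cdot E_2)\cdot E_3$; $\;0^*\cong 1^*\cong 1$; $\;(E^* )^*\cong E^*$. **Normalized expressions.** A normalized (regular) expression is one of the following syntactic objects: the symbol $0$; the symbol $1$; a letter; a *union* $E_1+E_2+\dots+E_n$ with $n\ge 2$, where $E_1,\dots,E_n$ are syntactically different normalized expressions, none of which is a union or equal to $0$, and the sequence $E_1,\dots,E_n$ is strictly increasing with respect to the fixed total ordering on normalized expressions; a *concatenation* $E_1\cdot E_2$, where $E_1,E_2$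 are normalized expressions not equal to $0$ or $1$ and $E_1$ is not a concatenation; or an *iteration* $E^*$, where $E$ is a normalized expression that is not equal to $0$ or $1$ and is not an iteration. **Operations on normalized expressions.** Let $E,E_1,E_2$ be normalized expressions. - $\oplus$: $0\oplus E=E\oplus 0=E$. If $E_1,E_2$ are both different from $0$, let, for $i=1,2$, $S_i=\{E_{i1},\dots,E_{in_i}\}$ if $E_i$ is the union $E_{i1}+\dots+E_{in_i}$, and $S_i=\{E_i\}$ otherwise. Let $F_1,\dots,F_m$ be the strictly increasing sequence (for the fixed total ordering) with $S_1\cup S_2=\{F_1,\dots,F_m\}$. Then $E_1\oplus E_2$ is the normalized expression $F_1+\dots+F_m$ if $m\ge 2$, and $F_1$ if $m=1$. - $\odot$: $0\odot E=E\odot 0=0$ and $1\odot E=E\odot 1=E$. If $E_1,E_2$ are both different from $0$ and $1$: if $E_1$ is not a concatenation, $E_1\odot E_2$ is the concatenation $E_1\cdot E_2$; otherwise $E_1=F_1\cdot F_2$ with $F_1$ not a concatenation, and $E_1\odot E_2=F_1\cdot G$ where $G=F_2\odot E_2$. - $\star$: $0\star=1\star=1$; if $E$ is an iteration, $E\star=E$; if $E$ is not an iteration and is different from $0$ and $1$, $E\star=E^*$. **Normalization.** The normalization $\overline{E}$ of a plain regular expression $E$ is defined by recursion: $\overline{0}=0$, $\overline{1}=1$, $\overline{x}=x$ for a letter $x$, $\overline{E_1+E_2}=\overline{E_1}\oplus\overline{E_2}$, $\overline{E_1\cdot E_2}=\overline{E_1}\odot\overline{E_2}$, $\overline{E^*}=\overline{E}\star$.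 *)

theory Defs
  imports Main
begin

section \<open>Plain regular expressions\<close>

datatype 'a rexp =
    Zero
  | One
  | Letter 'a
  | Plus "'a rexp" "'a rexp"
  | Times "'a rexp" "'a rexp"
  | Star "'a rexp"

text \<open>
  The letters form a set \<open>X\<close> (possibly empty) rather than a whole type. The congruence is relative
  to \<open>X\<close> as well: the axioms, e.g. \<open>0 \<cdot> E \<cong> 0\<close>, are instantiated with expressions over \<open>X\<close> only.
\<close>

definition rexps :: "'a set \<Rightarrow> 'a rexp set" where
  "rexps X = {E. set_rexp E \<subseteq> X}"

inductive rcong :: "'a set \<Rightarrow> 'a rexp \<Rightarrow> 'a rexp \<Rightarrow> bool" for X :: "'a set" where
  refl: "E \<in> rexps X \<Longrightarrow> rcong X E E"
| sym: "rcong X E F \<Longrightarrow> rcong X F E"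
| trans: "rcong X E F \<Longrightarrow> rcong X F G \<Longrightarrow> rcong X E G"
| Plus: "rcong X E E' \<Longrightarrow> rcong X F F' \<Longrightarrow> rcong X (Plus E F) (Plus E' F')"
| Times: "rcong X E E' \<Longrightarrow> rcong X F F' \<Longrightarrow> rcong X (Times E F) (Times E' F')"
| Star: "rcong X E E' \<Longrightarrow> rcong X (Star E) (Star E')"
| Plus_idem: "E \<in> rexps X \<Longrightarrow> rcong X (Plus E E) E"
| Zero_Plus: "E \<in> rexps X \<Longrightarrow> rcong X (Plus Zero E) E"
| Plus_Zero: "E \<in> rexps X \<Longrightarrow> rcong X (Plus E Zero) E"
| Zero_Times: "E \<in> rexps X \<Longrightarrow> rcong X (Times Zero E) Zero"
| Times_Zero: "E \<in> rexps X \<Longrightarrow> rcong X (Times E Zero) Zero"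
| One_Times: "E \<in> rexps X \<Longrightarrow> rcong X (Times One E) E"
| Times_One: "E \<in> rexps X \<Longrightarrow> rcong X (Times E One) E"
| Plus_assoc: "E\<^sub>1 \<in> rexps X \<Longrightarrow> E\<^sub>2 \<in> rexps X \<Longrightarrow> E\<^sub>3 \<in> rexps X \<Longrightarrow>
    rcong X (Plus E\<^sub>1 (Plus E\<^sub>2 E\<^sub>3)) (Plus (Plus E\<^sub>1 E\<^sub>2) E\<^sub>3)"
| Plus_commute: "E\<^sub>1 \<in> rexps X \<Longrightarrow> E\<^sub>2 \<in> rexps X \<Longrightarrow>
    rcong X (Plus E\<^sub>1 E\<^sub>2) (Plus E\<^sub>2 E\<^sub>1)"
| Times_assoc: "E\<^sub>1 \<in> rexps X \<Longrightarrow> E\<^sub>2 \<in> rexps X \<Longrightarrow> E\<^sub>3 \<in> rexps X \<Longrightarrow>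
    rcong X (Times E\<^sub>1 (Times E\<^sub>2 E\<^sub>3)) (Times (Times E\<^sub>1 E\<^sub>2) E\<^sub>3)"
| Star_Zero: "rcong X (Star Zero) One"
| Star_One: "rcong X (Star One) One"
| Star_Star: "E \<in> rexps X \<Longrightarrow> rcong X (Star (Star E)) (Star E)"


section \<open>Normalized expressions\<close>

text \<open>Raw syntax trees with an n-ary union; \<open>nrexps\<close> below singles out the normalized ones.\<close>

datatype 'a nrexp =
    NZero
  | NOne
  | NLetter 'a
  | is_NUnion: NUnion "'a nrexp list"
  | is_NConc: NConc "'a nrexp" "'a nrexp"
  | is_NIter: NIter "'a nrexp"

definition strictly_increasing :: "'b rel \<Rightarrow> 'b list \<Rightarrow> bool" where
  "strictly_increasing r = sorted_wrt (\<lambda>x y. (x, y) \<in> r \<and> x \<noteq> y)"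

text \<open>
  Normalized expressions and their ordering depend on each other: the ordering occurs in the
  definition of unions, and it orders the normalized expressions. Therefore \<open>nrexps X r\<close> is defined
  for an arbitrary relation \<open>r\<close>, and that \<open>r\<close> is a total ordering on the normalized expressions is
  expressed by \<open>linear_order_on (nrexps X r) r\<close>. Such \<open>r\<close> exist, see \<open>linear_order_on_nrexps\<close>.
\<close>

inductive_set nrexps :: "'a set \<Rightarrow> 'a nrexp rel \<Rightarrow> 'a nrexp set"
  for X :: "'a set" and r :: "'a nrexp rel" where
  NZero: "NZero \<in> nrexps X r"
| NOne: "NOne \<in> nrexps X r"
| NLetter: "x \<in> X \<Longrightarrow> NLetter x \<in> nrexps X r"
| NUnion: "2 \<le> length Es \<Longrightarrow>
    (\<And>E. E \<in> set Es \<Longrightarrow> E \<in> nrexps X r) \<Longrightarrow>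
    (\<And>E. E \<in> set Es \<Longrightarrow> \<not> is_NUnion E \<and> E \<noteq> NZero) \<Longrightarrow>
    distinct Es \<Longrightarrow> strictly_increasing r Es \<Longrightarrow> NUnion Es \<in> nrexps X r"
| NConc: "E\<^sub>1 \<in> nrexps X r \<Longrightarrow> E\<^sub>2 \<in> nrexps X r \<Longrightarrow>
    E\<^sub>1 \<notin> {NZero, NOne} \<Longrightarrow> E\<^sub>2 \<notin> {NZero, NOne} \<Longrightarrow> \<not> is_NConc E\<^sub>1 \<Longrightarrow>
    NConc E\<^sub>1 E\<^sub>2 \<in> nrexps X r"
| NIter: "E \<in> nrexps X r \<Longrightarrow> E \<notin> {NZero, NOne} \<Longrightarrow> \<not> is_NIter E \<Longrightarrow>
    NIter E \<in> nrexps X r"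

lemma nrexps_Restr_subset:
  assumes "E \<in> nrexps X R"
  shows "E \<in> nrexps X (Restr R (nrexps X R))"
  using assms
proof (induction rule: nrexps.induct)
  case (NUnion Es)
  have "strictly_increasing (Restr R (nrexps X R)) Es"
    using NUnion unfolding strictly_increasing_def
    by (auto intro: sorted_wrt_mono_rel[rotated])
  then show ?case using NUnion by (intro nrexps.NUnion) auto
qed (auto intro: nrexps.NZero nrexps.NOne nrexps.NLetter nrexps.NConc nrexps.NIter)

lemma nrexps_Restr: "nrexps X (Restr R (nrexps X R)) = nrexps X R"
proof
  show "nrexps X (Restr R (nrexps X R)) \<subseteq> nrexps X R"
  proof
    fix E assume "E \<in> nrexps X (Restr R (nrexps X R))"
    then show "E \<in> nrexps X R"
    proof (induction rule: nrexps.induct)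
      case (NUnion Es)
      have "strictly_increasing R Es"
        using NUnion unfolding strictly_increasing_def
        by (auto intro: sorted_wrt_mono_rel[rotated])
      then show ?case using NUnion by (intro nrexps.NUnion) auto
    qed (auto intro: nrexps.NZero nrexps.NOne nrexps.NLetter nrexps.NConc nrexps.NIter)
  qed
qed (use nrexps_Restr_subset in blast)

lemma linear_order_on_nrexps:
  fixes X :: "'a set" and R :: "'a nrexp rel"
  assumes "linear_order R"
  defines "r \<equiv> Restr R (nrexps X R)"
  shows "linear_order_on (nrexps X r) r"
proof -
  have "linear_order_on (nrexps X R) r"
    using assms(1) unfolding r_def linear_order_on_def partial_order_on_def preorder_on_def
      refl_on_def trans_def antisym_def total_on_def by blast
  then show ?thesis unfolding r_def nrexps_Restr .
qed


section \<open>Operations on normalized expressions\<close>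

fun summands :: "'a nrexp \<Rightarrow> 'a nrexp set" where
  "summands (NUnion Es) = set Es"
| "summands E = {E}"

definition increasing_list :: "'b rel \<Rightarrow> 'b set \<Rightarrow> 'b list" where
  "increasing_list r S = (THE Fs. strictly_increasing r Fs \<and> set Fs = S)"

definition nplus :: "'a nrexp rel \<Rightarrow> 'a nrexp \<Rightarrow> 'a nrexp \<Rightarrow> 'a nrexp" where
  "nplus r E\<^sub>1 E\<^sub>2 =
    (if E\<^sub>1 = NZero then E\<^sub>2
     else if E\<^sub>2 = NZero then E\<^sub>1
     else let Fs = increasing_list r (summands E\<^sub>1 \<union> summands E\<^sub>2)
          in if length Fs \<ge> 2 then NUnion Fs else hd Fs)"

fun ntimes :: "'a nrexp \<Rightarrow> 'a nrexp \<Rightarrow> 'a nrexp" where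
  "ntimes E\<^sub>1 E\<^sub>2 =
    (if E\<^sub>1 = NZero \<or> E\<^sub>2 = NZero then NZero
     else if E\<^sub>1 = NOne then E\<^sub>2
     else if E\<^sub>2 = NOne then E\<^sub>1
     else case E\<^sub>1 of NConc F\<^sub>1 F\<^sub>2 \<Rightarrow> NConc F\<^sub>1 (ntimes F\<^sub>2 E\<^sub>2) | _ \<Rightarrow> NConc E\<^sub>1 E\<^sub>2)"

declare ntimes.simps [simp del]

definition nstar :: "'a nrexp \<Rightarrow> 'a nrexp" where
  "nstar E =
    (if E = NZero \<or> E = NOne then NOne
     else if is_NIter E then E
     else NIter E)"

primrec normalization :: "'a nrexp rel \<Rightarrow> 'a rexp \<Rightarrow> 'a nrexp" where
  "normalization r Zero = NZero"
| "normalization r One = NOne"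
| "normalization r (Letter x) = NLetter x"
| "normalization r (Plus E\<^sub>1 E\<^sub>2) = nplus r (normalization r E\<^sub>1) (normalization r E\<^sub>2)"
| "normalization r (Times E\<^sub>1 E\<^sub>2) = ntimes (normalization r E\<^sub>1) (normalization r E\<^sub>2)"
| "normalization r (Star E) = nstar (normalization r E)"


text \<open>The operations, and hence the normalization, yield normalized expressions.\<close>

lemma increasing_list:
  assumes "linear_order_on A r" "finite S" "S \<subseteq> A"
  shows "strictly_increasing r (increasing_list r S) \<and> set (increasing_list r S) = S"
  unfolding increasing_list_def
proof (rule theI')
  let ?P = "\<lambda>x y. (x, y) \<in> r \<and> x \<noteq> y"
  have tr: "trans r" and an: "antisym r"
    and tot: "\<And>x y. x \<in> S \<Longrightarrow> y \<in> S \<Longrightarrow> x \<noteq> y \<Longrightarrow> (x, y) \<in> r \<or> (y, x) \<in> r"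
    using assms unfolding linear_order_on_def partial_order_on_def preorder_on_def total_on_def
    by auto
  have "\<exists>xs. strictly_increasing r xs \<and> set xs = S"
    using assms(2) tot
  proof (induction S rule: finite_induct)
    case empty
    then show ?case by (auto simp: strictly_increasing_def)
  next
    case (insert a S)
    have "\<exists>xs. strictly_increasing r xs \<and> set xs = S"
      by (rule insert.IH) (use insert.prems in blast)
    then obtain xs where xs: "sorted_wrt ?P xs" "set xs = S"
      unfolding strictly_increasing_def by blast
    define ls where "ls = filter (\<lambda>x. (x, a) \<in> r) xs"
    define us where "us = filter (\<lambda>x. (x, a) \<notin> r) xs"
    have u: "(a, x) \<in> r" if "x \<in> set us" for x
      using that insert.prems[of x a] insert.hyps xs(2) unfolding us_def by auto
    have l: "(x, a) \<in> r" if "x \<in> set ls" for x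
      using that unfolding ls_def by auto
    have ne: "a \<notin> set ls" "a \<notin> set us"
      using insert.hyps xs(2) unfolding ls_def us_def by auto
    have "(x, y) \<in> r \<and> x \<noteq> y" if "x \<in> set ls" "y \<in> set us" for x y
      using transD[OF tr l[OF that(1)] u[OF that(2)]] that unfolding ls_def us_def by auto
    moreover have "sorted_wrt ?P ls" "sorted_wrt ?P us"
      using xs(1) unfolding ls_def us_def by (simp_all only: sorted_wrt_filter)
    ultimately have "sorted_wrt ?P (ls @ a # us)"
      using u l ne by (auto simp: sorted_wrt_append)
    moreover have "set (ls @ a # us) = insert a S"
      using xs(2) unfolding ls_def us_def by auto
    ultimately show ?case unfolding strictly_increasing_def by blast
  qed
  moreover have "xs = ys"
    if "strictly_increasing r xs \<and> set xs = S" "strictly_increasing r ys \<and> set ys = S" for xs ys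
  proof -
    have "xs = ys" if "sorted_wrt ?P xs" "sorted_wrt ?P ys" "set xs = set ys" for xs ys
      using that
    proof (induction xs arbitrary: ys)
      case Nil
      then show ?case by simp
    next
      case (Cons x xs)
      then obtain y zs where ys: "ys = y # zs" by (cases ys) auto
      have "x = y"
      proof (rule ccontr)
        assume "x \<noteq> y"
        then have "x \<in> set zs" "y \<in> set xs" using Cons.prems(3) unfolding ys by auto
        then have "(y, x) \<in> r" "(x, y) \<in> r" using Cons.prems(1,2) unfolding ys by auto
        then show False using antisymD[OF an] \<open>x \<noteq> y\<close> by blast
      qed
      moreover have "set xs = set zs"
        using Cons.prems \<open>x = y\<close> unfolding ys by auto
      ultimately show ?case using Cons unfolding ys by auto
    qed
    then show ?thesis using that unfolding strictly_increasing_def by blast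
  qed
  ultimately show "\<exists>!xs. strictly_increasing r xs \<and> set xs = S" by blast
qed

lemma finite_summands: "finite (summands E)"
  by (cases E) auto

lemma summands_nrexps:
  assumes "E \<in> nrexps X r" "E \<noteq> NZero"
  shows "summands E \<subseteq> {F \<in> nrexps X r. \<not> is_NUnion F \<and> F \<noteq> NZero}" "summands E \<noteq> {}"
proof -
  have "summands E \<subseteq> {F \<in> nrexps X r. \<not> is_NUnion F \<and> F \<noteq> NZero} \<and> summands E \<noteq> {}"
  proof (cases "is_NUnion E")
    case True
    show ?thesis using assms(1) True by (cases rule: nrexps.cases) auto
  next
    case False
    then have "summands E = {E}" by (cases E) auto
    then show ?thesis using assms False by auto
  qed
  then show "summands E \<subseteq> {F \<in> nrexps X r. \<not> is_NUnion F \<and> F \<noteq> NZero}" "summands E \<noteq> {}"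
    by auto
qed

lemma nplus_in_nrexps:
  assumes lin: "linear_order_on (nrexps X r) r" and E: "E\<^sub>1 \<in> nrexps X r" "E\<^sub>2 \<in> nrexps X r"
  shows "nplus r E\<^sub>1 E\<^sub>2 \<in> nrexps X r"
proof (cases "E\<^sub>1 = NZero \<or> E\<^sub>2 = NZero")
  case True
  then show ?thesis using E by (auto simp: nplus_def)
next
  case False
  define S where "S = summands E\<^sub>1 \<union> summands E\<^sub>2"
  define Fs where "Fs = increasing_list r S"
  have S: "S \<subseteq> {F \<in> nrexps X r. \<not> is_NUnion F \<and> F \<noteq> NZero}" "S \<noteq> {}" "finite S"
    using summands_nrexps[OF E(1)] summands_nrexps[OF E(2)] False
    unfolding S_def by (auto simp: finite_summands)
  then have Fs: "strictly_increasing r Fs" "set Fs = S"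
    using increasing_list[OF lin, of S] unfolding Fs_def by auto
  from Fs(1) have "distinct Fs"
    unfolding strictly_increasing_def by (induction Fs) auto
  moreover have "hd Fs \<in> S" using S(2) Fs(2) by (metis hd_in_set set_empty)
  ultimately show ?thesis
    using False Fs S unfolding nplus_def S_def[symmetric] Fs_def[symmetric] Let_def
    by (auto intro!: nrexps.NUnion)
qed

lemma ntimes_NConc:
  "ntimes (NConc F\<^sub>1 F\<^sub>2) E =
    (if E = NZero then NZero else if E = NOne then NConc F\<^sub>1 F\<^sub>2 else NConc F\<^sub>1 (ntimes F\<^sub>2 E))"
  by (subst ntimes.simps) simp

lemma ntimes_not_NConc:
  "\<not> is_NConc E\<^sub>1 \<Longrightarrow> ntimes E\<^sub>1 E\<^sub>2 =
    (if E\<^sub>1 = NZero \<or> E\<^sub>2 = NZero then NZero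
     else if E\<^sub>1 = NOne then E\<^sub>2 else if E\<^sub>2 = NOne then E\<^sub>1 else NConc E\<^sub>1 E\<^sub>2)"
  by (subst ntimes.simps) (auto split: nrexp.split)

lemma ntimes_in_nrexps:
  assumes "E\<^sub>1 \<in> nrexps X r" "E\<^sub>2 \<in> nrexps X r"
  shows "ntimes E\<^sub>1 E\<^sub>2 \<in> nrexps X r \<and>
    (E\<^sub>1 \<notin> {NZero, NOne} \<longrightarrow> E\<^sub>2 \<notin> {NZero, NOne} \<longrightarrow> ntimes E\<^sub>1 E\<^sub>2 \<notin> {NZero, NOne})"
  using assms
proof (induction rule: nrexps.induct)
  case (NUnion Es)
  then have "NUnion Es \<in> nrexps X r" by (intro nrexps.NUnion) auto
  then show ?case
    using NUnion.prems by (simp add: ntimes_not_NConc nrexps.NZero nrexps.NConc)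
qed (auto simp: ntimes_NConc ntimes_not_NConc
    intro: nrexps.NZero nrexps.NOne nrexps.NLetter nrexps.NConc nrexps.NIter)

lemma nstar_in_nrexps: "E \<in> nrexps X r \<Longrightarrow> nstar E \<in> nrexps X r"
  by (auto simp: nstar_def intro: nrexps.NOne nrexps.NIter)

lemma normalization_in_nrexps:
  assumes "linear_order_on (nrexps X r) r"
  shows "E \<in> rexps X \<Longrightarrow> normalization r E \<in> nrexps X r"
  by (induction E)
    (auto simp: rexps_def nplus_in_nrexps[OF assms] ntimes_in_nrexps nstar_in_nrexps
      intro: nrexps.NZero nrexps.NOne nrexps.NLetter)

end

theory Submission
  imports Defs
begin

text \<open>
  Each defining equivalence of the congruence is an identity between the operations on normalized
  expressions. For those about union: a normalized expression is determined by its set of nonzero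
  summands, and \<open>\<oplus>\<close> acts on these sets as \<open>\<union>\<close>, which is associative, commutative and idempotent
  with neutral element \<open>\<emptyset>\<close>.
\<close>

text \<open>The head of a strictly increasing list lies below all later entries, so two different
  heads of lists with the same members would each lie below the other. This is how the list of a
  union is recovered from its set of members.\<close>

lemma strictly_increasing_unique:
  assumes "antisym r" "strictly_increasing r xs" "strictly_increasing r ys" "set xs = set ys"
  shows "xs = ys"
  using assms(2-4)
proof (induction xs arbitrary: ys)
  case Nil
  then show ?case by simp
next
  case (Cons x xs)
  then obtain y zs where ys: "ys = y # zs" by (cases ys) auto
  have "x = y"
  proof (rule ccontr)
    assume "x \<noteq> y"
    then have "x \<in> set zs" "y \<in> set xs" using Cons.prems(3) unfolding ys by auto
    then have "(y, x) \<in> r" "(x, y) \<in> r"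
      using Cons.prems(1,2) unfolding ys strictly_increasing_def by auto
    then show False using antisymD[OF assms(1)] \<open>x \<noteq> y\<close> by blast
  qed
  moreover have "set xs = set zs"
    using Cons.prems \<open>x = y\<close> unfolding ys strictly_increasing_def by auto
  ultimately show ?case using Cons unfolding ys strictly_increasing_def by auto
qed

lemma summands_not_NUnion: "\<not> is_NUnion E \<Longrightarrow> summands E = {E}"
  by (cases E) auto

text \<open>Separates unions from all other expressions, whose \<open>summands\<close> form a
  singleton: a union lists at least two entries, all distinct.\<close>

lemma summands_NUnion_neq_singleton:
  assumes "NUnion Es \<in> nrexps X r"
  shows "set Es \<noteq> {F}"
  using assms
proof (cases rule: nrexps.cases)
  case NUnion
  then have "card (set Es) \<ge> 2" by (simp add: distinct_card)
  then show ?thesis by auto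
qed

lemma summands_inj:
  assumes "antisym r" and E: "E \<in> nrexps X r" and F: "F \<in> nrexps X r"
    and eq: "summands E = summands F"
  shows "E = F"
proof (cases "is_NUnion E"; cases "is_NUnion F")
  assume "is_NUnion E" "is_NUnion F"
  then obtain Es Fs where EF: "E = NUnion Es" "F = NUnion Fs" by (auto simp: is_NUnion_def)
  have "strictly_increasing r Es" "strictly_increasing r Fs"
    using E F unfolding EF by (auto elim: nrexps.cases)
  then show ?thesis using strictly_increasing_unique[OF assms(1)] eq unfolding EF by auto
next
  assume "is_NUnion E" "\<not> is_NUnion F"
  then show ?thesis
    using E eq summands_NUnion_neq_singleton
    by (metis is_NUnion_def summands.simps(1) summands_not_NUnion)
next
  assume "\<not> is_NUnion E" "is_NUnion F"
  then show ?thesis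
    using F eq summands_NUnion_neq_singleton
    by (metis is_NUnion_def summands.simps(1) summands_not_NUnion)
next
  assume "\<not> is_NUnion E" "\<not> is_NUnion F"
  then show ?thesis using eq by (simp add: summands_not_NUnion)
qed

text \<open>Since \<open>summands NZero\<close> is \<open>{NZero}\<close>, removing
  \<open>NZero\<close> lets the neutral element of \<open>nplus\<close> correspond to the empty
  set.\<close>

definition nonzero_summands :: "'a nrexp \<Rightarrow> 'a nrexp set" where
  "nonzero_summands E = summands E - {NZero}"

lemma nonzero_summands_NZero [simp]: "nonzero_summands NZero = {}"
  by (simp add: nonzero_summands_def)

lemma nonzero_summands_eq_summands:
  "E \<in> nrexps X r \<Longrightarrow> E \<noteq> NZero \<Longrightarrow> nonzero_summands E = summands E"
  using summands_nrexps(1)[of E X r] by (auto simp: nonzero_summands_def)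

text \<open>Among normalized expressions only \<open>NZero\<close> yields the empty set; on the
  others nothing is removed and \<open>summands_inj\<close> applies.\<close>

lemma nonzero_summands_inj:
  assumes "antisym r" "E \<in> nrexps X r" "F \<in> nrexps X r"
    and "nonzero_summands E = nonzero_summands F"
  shows "E = F"
proof (cases "E = NZero \<or> F = NZero")
  case True
  then show ?thesis
    using assms(2-) summands_nrexps(2) nonzero_summands_eq_summands nonzero_summands_NZero by metis
next
  case False
  then show ?thesis using assms summands_inj nonzero_summands_eq_summands by metis
qed

lemma nonzero_summands_nplus:
  assumes lin: "linear_order_on (nrexps X r) r" and E: "E\<^sub>1 \<in> nrexps X r" "E\<^sub>2 \<in> nrexps X r"
  shows "nonzero_summands (nplus r E\<^sub>1 E\<^sub>2) = nonzero_summands E\<^sub>1 \<union> nonzero_summands E\<^sub>2"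
proof (cases "E\<^sub>1 = NZero \<or> E\<^sub>2 = NZero")
  case True
  then show ?thesis by (auto simp: nplus_def)
next
  case False
  define S where "S = summands E\<^sub>1 \<union> summands E\<^sub>2"
  define Fs where "Fs = increasing_list r S"
  have S: "S \<subseteq> {F \<in> nrexps X r. \<not> is_NUnion F \<and> F \<noteq> NZero}" "S \<noteq> {}" "finite S"
    using summands_nrexps[OF E(1)] summands_nrexps[OF E(2)] False
    unfolding S_def by (auto simp: finite_summands)
  then have Fs: "set Fs = S"
    using increasing_list[OF lin, of S] unfolding Fs_def by auto
  have "summands (nplus r E\<^sub>1 E\<^sub>2) = S"
  proof (cases "length Fs \<ge> 2")
    case True
    then show ?thesis
      using \<open>\<not> (E\<^sub>1 = NZero \<or> E\<^sub>2 = NZero)\<close> Fs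
      by (simp add: nplus_def flip: S_def Fs_def)
  next
    \<comment> \<open>Now \<open>nplus\<close> returns the only member of \<open>S\<close>. It is
      not a union, so it is its own single summand.\<close>
    case short: False
    have "Fs \<noteq> []" using Fs S(2) by auto
    then obtain F where F: "Fs = [F]" using short by (cases Fs; cases "tl Fs") auto
    then have "\<not> is_NUnion F" using Fs S(1) by auto
    then show ?thesis
      using False Fs F by (simp add: nplus_def summands_not_NUnion flip: S_def Fs_def)
  qed
  then show ?thesis by (auto simp: S_def nonzero_summands_def)
qed

lemma ntimes_NZero [simp]: "ntimes NZero E = NZero" "ntimes E NZero = NZero"
  by (simp_all add: ntimes.simps)

lemma ntimes_NOne [simp]: "ntimes NOne E = E" "ntimes E NOne = E"
  by (simp_all add: ntimes.simps)

text \<open>Keeps an inner product out of the special cases of \<open>ntimes\<close> when products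
  are nested.\<close>

lemma ntimes_not_NZero_NOne:
  "E\<^sub>1 \<notin> {NZero, NOne} \<Longrightarrow> E\<^sub>2 \<notin> {NZero, NOne} \<Longrightarrow> ntimes E\<^sub>1 E\<^sub>2 \<notin> {NZero, NOne}"
  by (subst ntimes.simps) (auto split: nrexp.split)

lemma ntimes_assoc: "ntimes E\<^sub>1 (ntimes E\<^sub>2 E\<^sub>3) = ntimes (ntimes E\<^sub>1 E\<^sub>2) E\<^sub>3"
proof (cases "{E\<^sub>1, E\<^sub>2, E\<^sub>3} \<inter> {NZero, NOne} = {}")
  case False
  then show ?thesis by auto
next
  case True
  then have E: "E\<^sub>2 \<notin> {NZero, NOne}" "E\<^sub>3 \<notin> {NZero, NOne}" by auto
  show ?thesis
    \<comment> \<open>These facts concern only \<open>E\<^sub>2\<close> and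
      \<open>E\<^sub>3\<close>, so for a concatenation the induction hypothesis applies to its right
      factor even if that is \<open>NZero\<close> or \<open>NOne\<close>.\<close>
    using ntimes_not_NZero_NOne[OF E] E
    by (induction E\<^sub>1) (auto simp: ntimes_NConc ntimes_not_NConc)
qed

lemma nstar_idem: "nstar (nstar E) = nstar E"
  by (simp add: nstar_def)

theorem theorem2:
  fixes X :: "'a set" and r :: "'a nrexp rel" and E E' :: "'a rexp"
  assumes "finite X"
    and "linear_order_on (nrexps X r) r"
    and "E \<in> rexps X" and "E' \<in> rexps X"
    and "rcong X E E'"
  shows "normalization r E = normalization r E'"
proof -
  note lin = assms(2)
  have "antisym r" using lin by (auto simp: linear_order_on_def partial_order_on_def)
  \<comment> \<open>Turns idempotence, associativity and commutativity of \<open>nplus\<close> into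
    the same laws for set union.\<close>
  note eqI = nonzero_summands_inj[OF this, of _ X]
  note [simp] = normalization_in_nrexps[OF lin] nplus_in_nrexps[OF lin]
    nonzero_summands_nplus[OF lin]
  show ?thesis
    using assms(5)
  proof (induction rule: rcong.induct)
    case (Plus_idem E)
    then show ?case by (intro eqI) simp_all
  next
    case (Plus_assoc E\<^sub>1 E\<^sub>2 E\<^sub>3)
    then show ?case by (intro eqI) (simp_all add: Un_assoc)
  next
    case (Plus_commute E\<^sub>1 E\<^sub>2)
    then show ?case by (intro eqI) (simp_all add: Un_commute)
  \<comment> \<open>Unfolding \<open>nplus\<close> and \<open>nstar\<close> settles the laws for
    \<open>Zero\<close> as a summand and for the star of \<open>Zero\<close> and
    \<open>One\<close>.\<close>
  qed (simp_all add: ntimes_assoc nstar_idem, simp_all add: nplus_def nstar_def)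
qed

end
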